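(* Let $p$ be a prime and let $m\ge 3$ be an integer such that $m\mid (p-1)$. Let $G$ be a semidirect product $G\cong C_p\rtimes C_m$, where $C_m$ acts faithfully on $C_p$. Then $\mathcal{N}_G\ge (\varphi(m)/2)-1$, with equality if $m$ is prime. Thus $\mathcal{N}_G>0$ if $m=5$ or $m\ge 7$.
   Context: $C_n$ denotes a cyclic group of order $n$, and $\varphi$ is the Euler function, $\varphi(n)=|(\mathbb{Z}/n)^\times|$. For a finite group $G$, two elements $g,h\in G$ are $\mathbb{R}$-$\mathrm{Aut}(G)$-conjugate if $g$ is in the $\mathrm{Aut}(G)$-orbit of $h$ or of $h^{-1}$; they are $\mathbb{Q}$-$\mathrm{Aut}(G)$-conjugate if the cyclic subgroups $\langle g\rangle$ and $\langle h\rangle$ are in the same $\mathrm{Aut}(G)$-orbit. Define $$\mathcal{N}_G = \#\{\mathbb{R}\text{-}\mathrm{Aut}(G)\text{-conjugacy classes in } G\} - \#\{\mathbb{Q}\text{-}\mathrm{Aut}(G)\text{-conjugacy classes in } G\}.$$ *)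

theory Defs
  imports "HOL-Algebra.Algebra" "HOL-Number_Theory.Totient"
begin

definition semidirect_product ::
  "('a, 'c) monoid_scheme \<Rightarrow> ('b, 'd) monoid_scheme \<Rightarrow> ('b \<Rightarrow> 'a \<Rightarrow> 'a) \<Rightarrow> ('a \<times> 'b) monoid"
  where "semidirect_product N H \<theta> =
    \<lparr>carrier = carrier N \<times> carrier H,
     monoid.mult = (\<lambda>(n, h) (n', h'). (n \<otimes>\<^bsub>N\<^esub> \<theta> h n', h \<otimes>\<^bsub>H\<^esub> h')),
     one = (\<one>\<^bsub>N\<^esub>, \<one>\<^bsub>H\<^esub>)\<rparr>"

definition R_Aut_conj :: "('a, 'c) monoid_scheme \<Rightarrow> ('a \<times> 'a) set"
  where "R_Aut_conj G = {(g, h). g \<in> carrier G \<and> h \<in> carrier G \<and>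
    (g \<in> orbit (AutoGroup G) (\<lambda>\<alpha>. \<alpha>) h \<or>
     g \<in> orbit (AutoGroup G) (\<lambda>\<alpha>. \<alpha>) (inv\<^bsub>G\<^esub> h))}"

definition Q_Aut_conj :: "('a, 'c) monoid_scheme \<Rightarrow> ('a \<times> 'a) set"
  where "Q_Aut_conj G = {(g, h). g \<in> carrier G \<and> h \<in> carrier G \<and>
    generate G {g} \<in> orbit (AutoGroup G) (\<lambda>\<alpha> S. \<alpha> ` S) (generate G {h})}"

text \<open>The difference is taken in the integers, not with truncated subtraction.\<close>

definition conj_class_defect :: "('a, 'c) monoid_scheme \<Rightarrow> int"
  where "conj_class_defect G =
    int (card (carrier G // R_Aut_conj G)) - int (card (carrier G // Q_Aut_conj G))"

context group
begin

lemma mem_orbit_AutoGroup: "y \<in> orbit (AutoGroup G) \<phi> x \<longleftrightarrow> (\<exists>\<alpha>\<in>auto G. y = \<phi> \<alpha> x)"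
  by (auto simp: orbit_def AutoGroup_def)

lemma auto_closed: "\<alpha> \<in> auto G \<Longrightarrow> x \<in> carrier G \<Longrightarrow> \<alpha> x \<in> carrier G"
  by (auto simp: auto_def hom_def)

lemma auto_inv: "\<alpha> \<in> auto G \<Longrightarrow> x \<in> carrier G \<Longrightarrow> \<alpha> (inv x) = inv (\<alpha> x)"
  using group_hom.hom_inv[of G G \<alpha> x] is_group
  by (auto simp: auto_def group_hom_def group_hom_axioms_def)

lemma auto_compose:
  assumes "\<alpha> \<in> auto G" "\<beta> \<in> auto G"
  shows "compose (carrier G) \<alpha> \<beta> \<in> auto G"
  using assms compose_Bij[of \<alpha> "carrier G" \<beta>]
  by (auto simp: auto_def hom_def compose_def Pi_iff)

lemma auto_inverse:
  assumes "\<alpha> \<in> auto G"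
  obtains \<beta> where "\<beta> \<in> auto G" "\<And>x. x \<in> carrier G \<Longrightarrow> \<beta> (\<alpha> x) = x"
proof -
  have b: "bij_betw \<alpha> (carrier G) (carrier G)"
    using assms by (simp add: auto_def Bij_def)
  let ?b = "restrict (inv_into (carrier G) \<alpha>) (carrier G)"
  have "?b \<in> auto G"
    using assms restrict_inv_into_Bij[of \<alpha> "carrier G"] restrict_inv_into_hom[of \<alpha>]
    by (auto simp: auto_def)
  moreover have "?b (\<alpha> x) = x" if "x \<in> carrier G" for x
    using b that by (auto simp: bij_betw_def)
  ultimately show ?thesis using that by blast
qed

lemma R_Aut_conj_iff:
  "(g, h) \<in> R_Aut_conj G \<longleftrightarrow> g \<in> carrier G \<and> h \<in> carrier G \<and>
    (\<exists>\<alpha>\<in>auto G. g = \<alpha> h \<or> g = inv (\<alpha> h))"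
  by (auto simp: R_Aut_conj_def mem_orbit_AutoGroup auto_inv)

lemma Q_Aut_conj_iff:
  "(g, h) \<in> Q_Aut_conj G \<longleftrightarrow> g \<in> carrier G \<and> h \<in> carrier G \<and>
    (\<exists>\<alpha>\<in>auto G. generate G {g} = \<alpha> ` generate G {h})"
  by (auto simp: Q_Aut_conj_def mem_orbit_AutoGroup)

lemma equiv_R_Aut_conj: "equiv (carrier G) (R_Aut_conj G)"
proof (rule equivI)
  show "R_Aut_conj G \<subseteq> carrier G \<times> carrier G"
    by (auto simp: R_Aut_conj_def)
  show "refl_on (carrier G) (R_Aut_conj G)"
  proof (rule refl_onI)
    fix x assume x: "x \<in> carrier G"
    show "(x, x) \<in> R_Aut_conj G"
      unfolding R_Aut_conj_iff
      using x by (intro conjI bexI[OF _ id_in_auto]) auto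
  qed
  show "sym (R_Aut_conj G)"
  proof (rule symI)
    fix g h assume "(g, h) \<in> R_Aut_conj G"
    then obtain \<alpha> where c: "g \<in> carrier G" "h \<in> carrier G"
      and a: "\<alpha> \<in> auto G" "g = \<alpha> h \<or> g = inv (\<alpha> h)"
      by (auto simp: R_Aut_conj_iff)
    obtain \<beta> where b: "\<beta> \<in> auto G" "\<And>x. x \<in> carrier G \<Longrightarrow> \<beta> (\<alpha> x) = x"
      using auto_inverse[OF a(1)] by blast
    have "h = \<beta> g \<or> h = inv (\<beta> g)"
      using a c b by (auto simp: auto_inv auto_closed)
    then show "(h, g) \<in> R_Aut_conj G" using b c by (auto simp: R_Aut_conj_iff)
  qed
  show "trans (R_Aut_conj G)"
  proof (rule transI)
    fix g h k assume "(g, h) \<in> R_Aut_conj G" "(h, k) \<in> R_Aut_conj G"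
    then obtain \<alpha> \<beta> where c: "g \<in> carrier G" "h \<in> carrier G" "k \<in> carrier G"
      and a: "\<alpha> \<in> auto G" "g = \<alpha> h \<or> g = inv (\<alpha> h)"
      and b: "\<beta> \<in> auto G" "h = \<beta> k \<or> h = inv (\<beta> k)"
      by (auto simp: R_Aut_conj_iff)
    have "g = compose (carrier G) \<alpha> \<beta> k \<or> g = inv (compose (carrier G) \<alpha> \<beta> k)"
      using a b c by (auto simp: compose_def auto_inv auto_closed)
    then show "(g, k) \<in> R_Aut_conj G"
      using auto_compose[OF a(1) b(1)] c by (auto simp: R_Aut_conj_iff)
  qed
qed

lemma equiv_Q_Aut_conj: "equiv (carrier G) (Q_Aut_conj G)"
proof (rule equivI)
  have sub: "generate G {x} \<subseteq> carrier G" if "x \<in> carrier G" for x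
    using that by (intro generate_incl) auto
  show "Q_Aut_conj G \<subseteq> carrier G \<times> carrier G"
    by (auto simp: Q_Aut_conj_def)
  show "refl_on (carrier G) (Q_Aut_conj G)"
  proof (rule refl_onI)
    fix x assume x: "x \<in> carrier G"
    have "generate G {x} = (\<lambda>x\<in>carrier G. x) ` generate G {x}"
      using sub[OF x] by (auto simp: image_iff subset_iff)
    then show "(x, x) \<in> Q_Aut_conj G"
      unfolding Q_Aut_conj_iff
      using x by (intro conjI bexI[OF _ id_in_auto])
  qed
  show "sym (Q_Aut_conj G)"
  proof (rule symI)
    fix g h assume "(g, h) \<in> Q_Aut_conj G"
    then obtain \<alpha> where c: "g \<in> carrier G" "h \<in> carrier G"
      and a: "\<alpha> \<in> auto G" "generate G {g} = \<alpha> ` generate G {h}"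
      by (auto simp: Q_Aut_conj_iff)
    obtain \<beta> where b: "\<beta> \<in> auto G" "\<And>x. x \<in> carrier G \<Longrightarrow> \<beta> (\<alpha> x) = x"
      using auto_inverse[OF a(1)] by blast
    have "\<beta> ` generate G {g} = (\<lambda>x. x) ` generate G {h}"
      unfolding a(2) image_image
      by (intro image_cong refl b(2)) (use sub[OF c(2)] in auto)
    then have "generate G {h} = \<beta> ` generate G {g}" by simp
    then show "(h, g) \<in> Q_Aut_conj G" using b(1) c by (auto simp: Q_Aut_conj_iff)
  qed
  show "trans (Q_Aut_conj G)"
  proof (rule transI)
    fix g h k assume "(g, h) \<in> Q_Aut_conj G" "(h, k) \<in> Q_Aut_conj G"
    then obtain \<alpha> \<beta> where c: "g \<in> carrier G" "h \<in> carrier G" "k \<in> carrier G"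
      and a: "\<alpha> \<in> auto G" "generate G {g} = \<alpha> ` generate G {h}"
      and b: "\<beta> \<in> auto G" "generate G {h} = \<beta> ` generate G {k}"
      by (auto simp: Q_Aut_conj_iff)
    have "generate G {g} = compose (carrier G) \<alpha> \<beta> ` generate G {k}"
      unfolding a(2) b(2) image_image
      by (intro image_cong refl) (use sub[OF c(3)] in \<open>auto simp: compose_def\<close>)
    then show "(g, k) \<in> Q_Aut_conj G"
      using auto_compose[OF a(1) b(1)] c by (auto simp: Q_Aut_conj_iff)
  qed
qed

end

lemma group_semidirect_product:
  assumes "group N" "group H" "\<theta> \<in> hom H (AutoGroup N)"
  shows "group (semidirect_product N H \<theta>)"
proof -
  interpret N: group N by fact
  interpret H: group H by fact
  interpret T: group_hom H "AutoGroup N" \<theta>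
    using assms N.AutoGroup by (simp add: group_hom_def group_hom_axioms_def)
  have t: "\<theta> h \<in> auto N" if "h \<in> carrier H" for h
    using T.hom_closed[OF that] by (simp add: AutoGroup_def)
  have cl: "\<theta> h n \<in> carrier N" if "h \<in> carrier H" "n \<in> carrier N" for h n
    using N.auto_closed[OF t] that by blast
  have hm: "\<theta> h (n \<otimes>\<^bsub>N\<^esub> n') = \<theta> h n \<otimes>\<^bsub>N\<^esub> \<theta> h n'"
    if "h \<in> carrier H" "n \<in> carrier N" "n' \<in> carrier N" for h n n'
    using t[OF that(1)] that by (auto simp: auto_def hom_def)
  have one: "\<theta> \<one>\<^bsub>H\<^esub> n = n" if "n \<in> carrier N" for n
    using that by (simp add: T.hom_one) (simp add: AutoGroup_def BijGroup_def)
  have mul: "\<theta> (h \<otimes>\<^bsub>H\<^esub> k) n = \<theta> h (\<theta> k n)"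
    if "h \<in> carrier H" "k \<in> carrier H" "n \<in> carrier N" for h k n
    using that t[of h] t[of k]
    by (simp add: T.hom_mult) (simp add: AutoGroup_def BijGroup_def auto_def compose_def)
  show ?thesis
  proof (rule groupI)
    fix x assume "x \<in> carrier (semidirect_product N H \<theta>)"
    then obtain n h where x: "x = (n, h)" "n \<in> carrier N" "h \<in> carrier H"
      by (auto simp: semidirect_product_def)
    have "\<theta> (inv\<^bsub>H\<^esub> h) (inv\<^bsub>N\<^esub> n) \<otimes>\<^bsub>N\<^esub> \<theta> (inv\<^bsub>H\<^esub> h) n = \<theta> (inv\<^bsub>H\<^esub> h) (inv\<^bsub>N\<^esub> n \<otimes>\<^bsub>N\<^esub> n)"
      using x hm[of "inv\<^bsub>H\<^esub> h" "inv\<^bsub>N\<^esub> n" n]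
      by (simp del: T.hom_inv)
    also have "\<dots> = \<one>\<^bsub>N\<^esub>"
      using x hm[of "inv\<^bsub>H\<^esub> h" "\<one>\<^bsub>N\<^esub>" "\<one>\<^bsub>N\<^esub>"] cl[of "inv\<^bsub>H\<^esub> h" "\<one>\<^bsub>N\<^esub>"]
      by (metis H.inv_closed N.l_inv N.l_cancel_one' N.one_closed N.r_one)
    finally show "\<exists>y\<in>carrier (semidirect_product N H \<theta>).
        y \<otimes>\<^bsub>semidirect_product N H \<theta>\<^esub> x = \<one>\<^bsub>semidirect_product N H \<theta>\<^esub>"
      using x
      by (intro bexI[of _ "(\<theta> (inv\<^bsub>H\<^esub> h) (inv\<^bsub>N\<^esub> n), inv\<^bsub>H\<^esub> h)"])
         (auto simp: semidirect_product_def cl simp del: T.hom_inv)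
  qed (auto simp: semidirect_product_def cl hm one mul N.m_assoc H.m_assoc
      simp del: T.hom_one T.hom_mult)
qed

end

theory Submission
  imports Defs
begin

text \<open>Every automorphism of \<open>S = C\<^sub>p \<rtimes> C\<^sub>m\<close> induces the identity on \<open>C\<^sub>m\<close>, since the conjugation action
  on \<open>C\<^sub>p\<close> is faithful and has values in the abelian group \<open>Aut C\<^sub>p\<close>. Hence an \<open>\<real>\<close>-class
  contains at most two of the elements \<open>(1, c)\<close>, namely those of \<open>c\<close> and \<open>c\<^sup>-\<^sup>1\<close>, whereas the
  \<open>\<phi>(m)\<close> elements with \<open>c\<close> a generator form part of a single \<open>\<rat>\<close>-class. As \<open>\<real>\<close>-conjugacy refines
  \<open>\<rat>\<close>-conjugacy, the lower bound follows. Moreover \<open>(n, c)\<close> is conjugate to \<open>(1, c)\<close> for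
  \<open>c \<noteq> 1\<close>, and the nontrivial elements of \<open>C\<^sub>p\<close> form one orbit; for \<open>m\<close> prime this gives at most
  \<open>2 + (m - 1) / 2\<close> \<open>\<real>\<close>-classes, while there are at least three \<open>\<rat>\<close>-classes.\<close>

section \<open>Counting equivalence classes\<close>

text \<open>The members of \<open>Y // R\<close> are full classes in \<open>A\<close>, which may
  stick out of \<open>Y\<close>; hence only their traces on \<open>Y\<close> are counted. These
  traces partition \<open>Y\<close>.\<close>

lemma card_eq_sum_quotient:
  assumes "equiv A R" "Y \<subseteq> A" "finite Y"
  shows "card Y = (\<Sum>K\<in>Y // R. card (K \<inter> Y))"
proof -
  have un: "Y = (\<Union>K\<in>Y // R. K \<inter> Y)"
    using assms(1,2) by (auto simp: quotient_def dest: equiv_class_self)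
  have dis: "(K \<inter> Y) \<inter> (L \<inter> Y) = {}" if "K \<in> Y // R" "L \<in> Y // R" "K \<noteq> L" for K L
  proof -
    have "Y // R \<subseteq> A // R" using assms(2) by (auto simp: quotient_def)
    then show ?thesis using quotient_disj[OF assms(1), of K L] that by blast
  qed
  have "finite (Y // R)" using assms(3) by (auto simp: quotient_def)
  then have "card (\<Union>K\<in>Y // R. K \<inter> Y) = (\<Sum>K\<in>Y // R. card (K \<inter> Y))"
    using dis assms(3) by (intro card_UN_disjoint) auto
  then show ?thesis using un by simp
qed

lemma card_le_mult_card_quotient:
  assumes "equiv A R" "Y \<subseteq> A" "finite Y" "\<And>x. x \<in> Y \<Longrightarrow> card (R `` {x} \<inter> Y) \<le> k"
  shows "card Y \<le> k * card (Y // R)"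
proof -
  have "(\<Sum>K\<in>Y // R. card (K \<inter> Y)) \<le> of_nat (card (Y // R)) * k"
    using assms(4) by (intro sum_bounded_above) (auto simp: quotient_def)
  then show ?thesis using card_eq_sum_quotient[OF assms(1-3)] by (simp add: mult.commute)
qed

lemma mult_card_quotient_le_card:
  assumes "equiv A R" "Y \<subseteq> A" "finite Y" "\<And>x. x \<in> Y \<Longrightarrow> k \<le> card (R `` {x} \<inter> Y)"
  shows "k * card (Y // R) \<le> card Y"
proof -
  have "of_nat (card (Y // R)) * k \<le> (\<Sum>K\<in>Y // R. card (K \<inter> Y))"
    using assms(4) by (intro sum_bounded_below) (auto simp: quotient_def)
  then show ?thesis using card_eq_sum_quotient[OF assms(1-3)] by (simp add: mult.commute)
qed

text \<open>Sending an \<open>R\<close>-class to the \<open>Q\<close>-class containing it is onto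
  and collapses all of \<open>Y // R\<close> to one point, so passing from \<open>R\<close> to
  \<open>Q\<close> loses at least \<open>card (Y // R) - 1\<close> classes. This turns many
  \<open>R\<close>-classes inside a single \<open>Q\<close>-class into a lower bound for the
  defect.\<close>

lemma card_quotient_refinement:
  assumes R: "equiv A R" and Q: "equiv A Q" and RQ: "R \<subseteq> Q" and "finite A"
    and "Y \<subseteq> A" "Y \<times> Y \<subseteq> Q" "Y \<noteq> {}"
  shows "card (A // Q) + card (Y // R) \<le> card (A // R) + 1"
proof -
  obtain x0 where x0: "x0 \<in> Y" using assms by blast
  have fin: "finite (A // R)" using \<open>finite A\<close> by (auto simp: quotient_def)
  have sub: "Y // R \<subseteq> A // R" using assms(5) by (auto simp: quotient_def)
  \<comment> \<open>As \<open>R\<close> refines \<open>Q\<close>, the image of an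
    \<open>R\<close>-class under \<open>Q\<close> is one \<open>Q\<close>-class. The class of
    \<open>x0\<close> stands for everything that meets \<open>Y\<close>.\<close>
  have "A // Q \<subseteq> insert (Q `` {x0}) ((``) Q ` (A // R - Y // R))"
  proof
    fix q assume "q \<in> A // Q"
    then obtain x where x: "x \<in> A" "q = Q `` {x}" by (rule quotientE)
    show "q \<in> insert (Q `` {x0}) ((``) Q ` (A // R - Y // R))"
    proof (cases "R `` {x} \<in> Y // R")
      case True
      then obtain y where y: "y \<in> Y" "R `` {x} = R `` {y}" by (rule quotientE)
      have "(x, y) \<in> R" using y x(1) assms(5) R by (auto simp: eq_equiv_class_iff)
      then have "(x, y) \<in> Q" "(y, x0) \<in> Q" using RQ assms(6) y(1) x0 by auto
      then show ?thesis using x(2) Q by (metis equiv_class_eq insertI1)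
    next
      case False
      have "(x, x) \<in> R" using R x(1) by (meson equivE refl_onD)
      then have "Q `` (R `` {x}) = Q `` {x}"
        using RQ Q by (auto dest: equiv_class_eq)
      then have "q = Q `` (R `` {x})" using x(2) by simp
      moreover have "R `` {x} \<in> A // R - Y // R" using False x(1) by (simp add: quotientI)
      ultimately show ?thesis by blast
    qed
  qed
  then have "card (A // Q) \<le> card (insert (Q `` {x0}) ((``) Q ` (A // R - Y // R)))"
    using fin by (intro card_mono) auto
  also have "\<dots> \<le> Suc (card (A // R - Y // R))"
    using fin card_image_le[of "A // R - Y // R" "(``) Q"]
    by (simp add: card_insert_if le_SucI)
  also have "card (A // R - Y // R) = card (A // R) - card (Y // R)"
    using fin sub by (intro card_Diff_subset) (auto intro: finite_subset)
  finally show ?thesis using card_mono[OF fin sub] by linarith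
qed

text \<open>Since \<open>f\<close> only reflects the relations, it need not descend to classes.
  Applying it to a chosen representative of each class still gives an injection.\<close>

lemma card_quotient_le_if_reflects:
  assumes "equiv A R" "equiv B S" "finite B"
    and "\<And>x. x \<in> A \<Longrightarrow> f x \<in> B"
    and "\<And>x y. x \<in> A \<Longrightarrow> y \<in> A \<Longrightarrow> (f x, f y) \<in> S \<Longrightarrow> (x, y) \<in> R"
  shows "card (A // R) \<le> card (B // S)"
proof -
  define g where "g K = S `` {f (SOME x. x \<in> K \<and> x \<in> A)}" for K
  have g: "\<exists>x\<in>A. K = R `` {x} \<and> g K = S `` {f x}" if K: "K \<in> A // R" for K
  proof -
    obtain y where y: "y \<in> A" "K = R `` {y}" using K by (rule quotientE)
    then have "y \<in> K \<and> y \<in> A" using equiv_class_self[OF assms(1)] by simp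
    then have "(SOME x. x \<in> K \<and> x \<in> A) \<in> K \<and> (SOME x. x \<in> K \<and> x \<in> A) \<in> A" by (rule someI)
    then show ?thesis
      using y(2) assms(1) by (intro bexI[of _ "SOME x. x \<in> K \<and> x \<in> A"]) (auto simp: g_def dest: equiv_class_eq)
  qed
  have "inj_on g (A // R)"
  proof (rule inj_onI)
    fix K L assume KL: "K \<in> A // R" "L \<in> A // R" "g K = g L"
    obtain x y where x: "x \<in> A" "K = R `` {x}" "g K = S `` {f x}"
      and y: "y \<in> A" "L = R `` {y}" "g L = S `` {f y}"
      using g KL by meson
    then have "(f x, f y) \<in> S" using KL(3) assms(2,4) by (simp add: eq_equiv_class_iff)
    then have "(x, y) \<in> R" using assms(5) x y by blast
    then show "K = L" using x(2) y(2) assms(1) by (simp add: equiv_class_eq)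
  qed
  moreover have "g ` (A // R) \<subseteq> B // S"
    using g assms(4) by (force intro: quotientI)
  moreover have "finite (B // S)" using assms(3) by (auto simp: quotient_def)
  ultimately show ?thesis by (rule card_inj_on_le)
qed

section \<open>A lower bound for the Euler function\<close>

text \<open>Besides 1 and \<open>m - 1\<close> there is a third totative strictly between them: 2
  for odd \<open>m\<close>, and a number just above \<open>m / 2\<close> for even
  \<open>m\<close>.\<close>

lemma totient_gt_2:
  assumes "m = 5 \<or> m \<ge> 7"
  shows "totient m > 2"
proof -
  obtain a where a: "coprime a m" "1 < a" "a < m - 1"
  proof (cases "even m")
    case False
    then show ?thesis using that[of 2] assms by auto
  next
    case True
    then obtain n where n: "m = 2 * n" by blast
    \<comment> \<open>Adding 1 or 2 to \<open>m / 2\<close> gives an odd number whose gcd with \<open>m\<close> divides 4.\<close>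
    define d :: nat where "d = (if even n then 1 else 2)"
    have odd: "odd (n + d)" and d: "2 * d dvd 4" by (auto simp: d_def)
    have "coprime (n + d) m"
    proof (rule coprimeI)
      fix c assume c: "c dvd n + d" "c dvd m"
      have "c dvd 2 * (n + d)" using c(1) by (rule dvd_mult)
      then have "c dvd 2 * (n + d) - m" using c(2) by (rule dvd_diff_nat)
      then have "c dvd 2 * d" using n by simp
      then have "c dvd 2 ^ 2" using d by (simp add: dvd_trans)
      moreover have "coprime c 2" using c(1) odd by (meson coprime_right_2_iff_odd dvd_trans)
      ultimately show "is_unit c"
        by (metis coprime_absorb_left coprime_power_right_iff coprime_common_divisor dvd_refl)
    qed
    moreover have "n \<ge> 4" using assms n by presburger
    then have "1 < n + d" "n + d < m - 1" using n by (auto simp: d_def)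
    ultimately show ?thesis using that by blast
  qed
  have "coprime (m - 1) m" using assms by (intro coprime_diff_one_left_nat) auto
  then have "{1, a, m - 1} \<subseteq> totatives m"
    using a assms by (auto simp: in_totatives_iff)
  then have "card {1, a, m - 1} \<le> totient m"
    unfolding totient_def by (intro card_mono) auto
  moreover have "card {1, a, m - 1} = 3" using a by auto
  ultimately show ?thesis by simp
qed

section \<open>Real and rational conjugacy in an arbitrary group\<close>

context group
begin

text \<open>An element and its inverse generate the same subgroup, and automorphisms commute with
  \<open>generate\<close>.\<close>

lemma R_Aut_conj_subset_Q_Aut_conj: "R_Aut_conj G \<subseteq> Q_Aut_conj G"
proof clarify
  fix g h assume "(g, h) \<in> R_Aut_conj G"
  then obtain \<alpha> where c: "g \<in> carrier G" "h \<in> carrier G"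
    and a: "\<alpha> \<in> auto G" "g = \<alpha> h \<or> g = inv (\<alpha> h)"
    by (auto simp: R_Aut_conj_iff)
  interpret a: group_hom G G \<alpha>
    using a(1) is_group by (auto simp: auto_def group_hom_def group_hom_axioms_def)
  have inv: "generate G {inv x} = generate G {x}" if "x \<in> carrier G" for x
  proof -
    have "generate G {inv y} \<subseteq> generate G {y}" if "y \<in> carrier G" for y
      using that by (intro generate_subgroup_incl generate_is_subgroup) (auto intro: generate.inv)
    from this[of x] this[of "inv x"] that show ?thesis by auto
  qed
  have "generate G {g} = generate G {\<alpha> h}"
    using a(2) c auto_closed[OF a(1)] inv by auto
  also have "\<dots> = \<alpha> ` generate G {h}"
    using a.generate_img[of "{h}"] c by simp
  finally show "(g, h) \<in> Q_Aut_conj G" using a(1) c by (auto simp: Q_Aut_conj_iff)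
qed

text \<open>The inner automorphism of \<open>x\<close> carries \<open>h\<close> to \<open>g\<close>.
  The inverse-free hypothesis can be checked in a semidirect product by multiplying pairs.\<close>

lemma R_Aut_conj_if_conjugate:
  assumes "x \<in> carrier G" "g \<in> carrier G" "h \<in> carrier G" "x \<otimes> h = g \<otimes> x"
  shows "(g, h) \<in> R_Aut_conj G"
proof -
  let ?\<alpha> = "\<lambda>y\<in>carrier G. x \<otimes> y \<otimes> inv x"
  have "x \<otimes> (y \<otimes> z) \<otimes> inv x = (x \<otimes> y \<otimes> inv x) \<otimes> (x \<otimes> z \<otimes> inv x)"
    if "y \<in> carrier G" "z \<in> carrier G" for y z
  proof -
    have "inv x \<otimes> (x \<otimes> (z \<otimes> inv x)) = z \<otimes> inv x"
      using that assms(1) by (simp add: m_assoc[symmetric])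
    then show ?thesis using that assms(1) by (simp add: m_assoc)
  qed
  then have "?\<alpha> \<in> auto G"
    using conjugation_is_bij[OF assms(1)] assms(1) by (auto simp: auto_def Bij_def hom_def)
  moreover have "g = ?\<alpha> h" using assms by (simp add: m_assoc)
  ultimately show ?thesis using assms unfolding R_Aut_conj_iff by blast
qed

lemma R_Aut_conj_inv:
  assumes "x \<in> carrier G"
  shows "(x, inv x) \<in> R_Aut_conj G"
  unfolding R_Aut_conj_iff using assms by (intro conjI bexI[OF _ id_in_auto]) auto

lemma Q_Aut_conj_if_generate_eq:
  assumes "x \<in> carrier G" "y \<in> carrier G" "generate G {x} = generate G {y}"
  shows "(x, y) \<in> Q_Aut_conj G"
proof -
  have "generate G {y} \<subseteq> carrier G" using assms(2) by (intro generate_incl) auto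
  then have "(\<lambda>z\<in>carrier G. z) ` generate G {y} = generate G {y}" by (force simp: image_iff)
  then show ?thesis
    unfolding Q_Aut_conj_iff using assms by (intro conjI bexI[OF _ id_in_auto]) auto
qed

lemma auto_one: "\<alpha> \<in> auto G \<Longrightarrow> \<alpha> \<one> = \<one>"
  using hom_one[of \<alpha> G G] is_group by (auto simp: auto_def)

lemma Q_Aut_conj_one:
  assumes "(x, \<one>) \<in> Q_Aut_conj G"
  shows "x = \<one>"
proof -
  obtain \<alpha> where "\<alpha> \<in> auto G" "generate G {x} = \<alpha> ` generate G {\<one>}"
    using assms unfolding Q_Aut_conj_iff by blast
  then have "generate G {x} = {\<one>}" by (simp add: generate_one auto_one)
  then show ?thesis using generate.incl[of x "{x}" G] by simp
qed

section \<open>Invariance of the defect under isomorphism\<close>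

text \<open>The automorphism \<open>\<beta>\<close> is \<open>\<alpha>\<close> conjugated by
  \<open>\<psi>\<close>, restricted to the carrier because members of \<open>auto\<close> must be
  extensional.\<close>

lemma auto_transport:
  assumes "group H" "\<psi> \<in> iso G H" "\<alpha> \<in> auto G"
  obtains \<beta> where "\<beta> \<in> auto H" "\<And>x. x \<in> carrier G \<Longrightarrow> \<beta> (\<psi> x) = \<psi> (\<alpha> x)"
proof -
  let ?i = "inv_into (carrier G) \<psi>"
  let ?b = "restrict (\<psi> \<circ> (\<alpha> \<circ> ?i)) (carrier H)"
  have i: "?i \<in> iso H G" using assms(2) by (rule iso_set_sym)
  have "\<alpha> \<in> iso G G" using assms(3) by (auto simp: auto_def Bij_def iso_def)
  then have b: "\<psi> \<circ> (\<alpha> \<circ> ?i) \<in> iso H H"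
    using iso_set_trans[OF iso_set_trans[OF i] assms(2)] by blast
  then have "?b \<in> auto H"
    using group.is_monoid[OF assms(1)]
    by (auto simp: auto_def Bij_def iso_def hom_def Pi_iff monoid.m_closed cong: bij_betw_cong)
  moreover have "?b (\<psi> x) = \<psi> (\<alpha> x)" if "x \<in> carrier G" for x
    using assms(2) that by (auto simp: iso_def bij_betw_def)
  ultimately show ?thesis using that by blast
qed

lemma R_Aut_conj_iso:
  assumes "group H" "\<psi> \<in> iso G H" "(g, h) \<in> R_Aut_conj G"
  shows "(\<psi> g, \<psi> h) \<in> R_Aut_conj H"
proof -
  interpret H: group H by fact
  interpret f: group_hom G H \<psi>
    using assms(2) by unfold_locales (auto simp: iso_def)
  obtain \<alpha> where c: "g \<in> carrier G" "h \<in> carrier G"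
    and a: "\<alpha> \<in> auto G" "g = \<alpha> h \<or> g = inv (\<alpha> h)"
    using assms(3) by (auto simp: R_Aut_conj_iff)
  obtain \<beta> where "\<beta> \<in> auto H" "\<And>x. x \<in> carrier G \<Longrightarrow> \<beta> (\<psi> x) = \<psi> (\<alpha> x)"
    using auto_transport[OF assms(1,2) a(1)] by blast
  moreover from this have "\<psi> g = \<beta> (\<psi> h) \<or> \<psi> g = inv\<^bsub>H\<^esub> (\<beta> (\<psi> h))"
    using a c auto_closed[OF a(1)] by auto
  ultimately show ?thesis using c f.hom_closed unfolding H.R_Aut_conj_iff by blast
qed

lemma Q_Aut_conj_iso:
  assumes "group H" "\<psi> \<in> iso G H" "(g, h) \<in> Q_Aut_conj G"
  shows "(\<psi> g, \<psi> h) \<in> Q_Aut_conj H"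
proof -
  interpret H: group H by fact
  interpret f: group_hom G H \<psi>
    using assms(2) by unfold_locales (auto simp: iso_def)
  obtain \<alpha> where c: "g \<in> carrier G" "h \<in> carrier G"
    and a: "\<alpha> \<in> auto G" "generate G {g} = \<alpha> ` generate G {h}"
    using assms(3) by (auto simp: Q_Aut_conj_iff)
  obtain \<beta> where b: "\<beta> \<in> auto H" "\<And>x. x \<in> carrier G \<Longrightarrow> \<beta> (\<psi> x) = \<psi> (\<alpha> x)"
    using auto_transport[OF assms(1,2) a(1)] by blast
  have sub: "generate G {h} \<subseteq> carrier G" using c by (intro generate_incl) auto
  have "generate H {\<psi> g} = \<psi> ` \<alpha> ` generate G {h}"
    using f.generate_img[of "{g}"] c a(2) by simp
  also have "\<dots> = \<beta> ` \<psi> ` generate G {h}"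
    using b(2) sub by (force simp: image_image intro!: image_cong)
  also have "\<dots> = \<beta> ` generate H {\<psi> h}"
    using f.generate_img[of "{h}"] c by simp
  finally show ?thesis using b(1) c by (auto simp: H.Q_Aut_conj_iff)
qed

text \<open>As \<open>\<psi>\<close> preserves both relations, its inverse reflects them. Applied to
  the inverse isomorphism as well, the inequalities become equalities.\<close>

lemma card_Aut_conj_le_iso:
  assumes "group H" "\<psi> \<in> iso G H" "finite (carrier G)"
  shows "card (carrier H // R_Aut_conj H) \<le> card (carrier G // R_Aut_conj G)"
    and "card (carrier H // Q_Aut_conj H) \<le> card (carrier G // Q_Aut_conj G)"
proof -
  interpret H: group H by fact
  let ?i = "inv_into (carrier G) \<psi>"
  have i: "?i x \<in> carrier G" "\<psi> (?i x) = x" if "x \<in> carrier H" for x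
    using assms(2) that by (auto simp: iso_def bij_betw_def intro: inv_into_into f_inv_into_f)
  show "card (carrier H // R_Aut_conj H) \<le> card (carrier G // R_Aut_conj G)"
    using R_Aut_conj_iso[OF assms(1,2)] i
    by (intro card_quotient_le_if_reflects[OF H.equiv_R_Aut_conj equiv_R_Aut_conj assms(3), of ?i]) metis+
  show "card (carrier H // Q_Aut_conj H) \<le> card (carrier G // Q_Aut_conj G)"
    using Q_Aut_conj_iso[OF assms(1,2)] i
    by (intro card_quotient_le_if_reflects[OF H.equiv_Q_Aut_conj equiv_Q_Aut_conj assms(3), of ?i]) metis+
qed

lemma conj_class_defect_iso:
  assumes "group H" "G \<cong> H" "finite (carrier G)"
  shows "conj_class_defect G = conj_class_defect H"
proof -
  interpret H: group H by fact
  obtain \<psi> where psi: "\<psi> \<in> iso G H" using assms(2) by (auto simp: is_iso_def)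
  have "finite (carrier H)"
    using psi assms(3) bij_betw_finite[of \<psi> "carrier G" "carrier H"] by (simp add: iso_def)
  then show ?thesis
    unfolding conj_class_defect_def
    using card_Aut_conj_le_iso[OF assms(1) psi assms(3)]
      H.card_Aut_conj_le_iso[OF is_group iso_set_sym[OF psi]]
    by simp
qed

section \<open>Cyclic groups and their generators\<close>

text \<open>An endomorphism is determined by its value on a generator, hence is a power map, and
  power maps commute.\<close>

lemma endomorphisms_commute_if_cyclic:
  assumes "cyclic_group G" "f \<in> hom G G" "g \<in> hom G G" "x \<in> carrier G"
  shows "f (g x) = g (f x)"
proof -
  obtain a where a: "a \<in> carrier G" "carrier G = range (\<lambda>n::int. a [^] n)"
    using assms(1) unfolding cyclic_group by blast
  interpret f: group_hom G G f using assms(2) by unfold_locales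
  interpret g: group_hom G G g using assms(3) by unfold_locales
  obtain i j k :: int where "f a = a [^] i" "g a = a [^] j" "x = a [^] k"
    using a f.hom_closed[OF a(1)] g.hom_closed[OF a(1)] assms(4) by (metis imageE)
  then show ?thesis
    using a(1) by (simp add: f.hom_int_pow g.hom_int_pow int_pow_pow mult.commute mult.left_commute)
qed

lemma generate_eq_carrier_if_prime_order:
  assumes "Factorial_Ring.prime (order G)" "x \<in> carrier G" "x \<noteq> \<one>"
  shows "generate G {x} = carrier G"
proof -
  have fin: "finite (carrier G)"
    using assms(1) by (metis card.infinite not_prime_0 order_def)
  have "ord x dvd order G" "ord x \<noteq> 1"
    using assms ord_dvd_group_order ord_eq_1 by auto
  then have "card (generate G {x}) = card (carrier G)"
    using assms(1,2) generate_pow_card[of x] by (auto simp: prime_nat_iff order_def)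
  moreover have "generate G {x} \<subseteq> carrier G" using assms(2) by (intro generate_incl) auto
  ultimately show ?thesis using fin by (intro card_subset_eq)
qed

lemma generate_pow_coprime:
  assumes "finite (carrier G)" "x \<in> carrier G" "generate G {x} = carrier G" "coprime k (order G)"
  shows "generate G {x [^] k} = carrier G"
proof -
  have "ord x = order G" using generate_pow_card[of x] assms by (simp add: order_def)
  then have "ord (x [^] k) = order G"
    using pow_ord_eq_ord_iff[OF assms(1,2), of k] assms(4) by simp
  then have "card (generate G {x [^] k}) = card (carrier G)"
    using generate_pow_card[of "x [^] k"] assms(2) by (simp add: order_def)
  moreover have "generate G {x [^] k} \<subseteq> carrier G" using assms(2) by (intro generate_incl) auto
  ultimately show ?thesis using assms(1) by (intro card_subset_eq)
qed

text \<open>The powers of a fixed generator with exponents in \<open>totatives (order G)\<close> are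
  distinct generators.\<close>

lemma totient_le_card_generators:
  assumes "cyclic_group G" "finite (carrier G)"
  shows "totient (order G) \<le> card {x \<in> carrier G. generate G {x} = carrier G}"
proof -
  obtain a where a: "a \<in> carrier G" "carrier G = range (\<lambda>n::int. a [^] n)"
    using assms(1) unfolding cyclic_group by blast
  then have gen: "generate G {a} = carrier G" by (auto simp: generate_pow)
  have ord: "ord a = order G" using generate_pow_card[of a] a(1) gen by (simp add: order_def)
  have "inj_on (\<lambda>k. a [^] k) {1..ord a}" using ord_inj' a(1) by blast
  then have "inj_on (\<lambda>k. a [^] k) (totatives (order G))"
    by (rule inj_on_subset) (auto simp: ord in_totatives_iff)
  moreover have "(\<lambda>k. a [^] k) ` totatives (order G) \<subseteq> {x \<in> carrier G. generate G {x} = carrier G}"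
    using generate_pow_coprime[OF assms(2) a(1) gen] a(1) by (auto simp: in_totatives_iff)
  ultimately show ?thesis
    unfolding totient_def using assms(2) by (intro card_inj_on_le) auto
qed

end

section \<open>The semidirect product and its structure maps\<close>

locale faithful_prime_semidirect_product = P: group P + C: group C
  for P :: "('a, 'x) monoid_scheme" and C :: "('b, 'y) monoid_scheme"
    and \<theta> :: "'b \<Rightarrow> 'a \<Rightarrow> 'a" +
  assumes cyclic_P: "cyclic_group P" and prime_order_P: "Factorial_Ring.prime (order P)"
    and cyclic_C: "cyclic_group C" and order_C_dvd: "order C dvd order P - 1"
    and action_hom: "\<theta> \<in> hom C (AutoGroup P)" and action_inj: "inj_on \<theta> (carrier C)"
begin

abbreviation "S \<equiv> semidirect_product P C \<theta>"

sublocale S: group S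
  using P.is_group C.is_group action_hom by (rule group_semidirect_product)

sublocale P: comm_group P
  using cyclic_P by (rule P.cyclic_imp_abelian_group)

sublocale action: group_hom C "AutoGroup P" \<theta>
  using C.is_group P.AutoGroup action_hom by (simp add: group_hom_def group_hom_axioms_def)

lemma carrier_S: "carrier S = carrier P \<times> carrier C"
  by (simp add: semidirect_product_def)

lemma mult_S: "(n, c) \<otimes>\<^bsub>S\<^esub> (n', c') = (n \<otimes>\<^bsub>P\<^esub> \<theta> c n', c \<otimes>\<^bsub>C\<^esub> c')"
  by (simp add: semidirect_product_def)

lemma one_S: "\<one>\<^bsub>S\<^esub> = (\<one>\<^bsub>P\<^esub>, \<one>\<^bsub>C\<^esub>)"
  by (simp add: semidirect_product_def)

lemma finite_P: "finite (carrier P)"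
  using prime_order_P by (metis card.infinite not_prime_0 order_def)

text \<open>An infinite group has \<open>order\<close> 0, and 0 does not divide the positive number
  \<open>order P - 1\<close>; so the divisibility hypothesis also makes \<open>C\<close>
  finite.\<close>

lemma order_C_pos: "order C > 0"
  using order_C_dvd prime_gt_1_nat[OF prime_order_P] by (intro Nat.gr0I) auto

lemma finite_C: "finite (carrier C)"
  using order_C_pos by (simp add: order_def card_gt_0_iff)

lemma finite_S: "finite (carrier S)"
  using finite_P finite_C by (simp add: carrier_S)

lemma coprime_orders: "coprime (order P) (order C)"
proof -
  have "coprime (order P) (order P - 1)"
    using prime_gt_1_nat[OF prime_order_P] by (intro coprime_diff_one_right_nat) auto
  then show ?thesis using order_C_dvd by (meson coprime_divisors dvd_refl)
qed

lemma action_auto: "c \<in> carrier C \<Longrightarrow> \<theta> c \<in> auto P"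
  using action.hom_closed by (simp add: AutoGroup_def)

lemma action_group_hom: "c \<in> carrier C \<Longrightarrow> group_hom P P (\<theta> c)"
  using action_auto P.is_group by (auto simp: auto_def group_hom_def group_hom_axioms_def)

lemma action_closed: "c \<in> carrier C \<Longrightarrow> n \<in> carrier P \<Longrightarrow> \<theta> c n \<in> carrier P"
  using P.auto_closed action_auto by blast

lemma action_one [simp]: "n \<in> carrier P \<Longrightarrow> \<theta> \<one>\<^bsub>C\<^esub> n = n"
  by (simp add: action.hom_one) (simp add: AutoGroup_def BijGroup_def)

lemmas [simp del] = action.hom_one

lemma action_unit [simp]: "c \<in> carrier C \<Longrightarrow> \<theta> c \<one>\<^bsub>P\<^esub> = \<one>\<^bsub>P\<^esub>"
  using group_hom.hom_one[OF action_group_hom] .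

text \<open>Members of \<open>auto P\<close> are extensional, so agreement on the carrier is
  equality of functions, to which faithfulness applies.\<close>

lemma action_eqI:
  assumes "c \<in> carrier C" "d \<in> carrier C" "\<And>n. n \<in> carrier P \<Longrightarrow> \<theta> c n = \<theta> d n"
  shows "c = d"
proof -
  have "\<theta> c \<in> extensional (carrier P)" "\<theta> d \<in> extensional (carrier P)"
    using action_auto assms(1,2) by (auto simp: auto_def Bij_def)
  then have "\<theta> c = \<theta> d" using assms(3) by (rule extensionalityI)
  then show ?thesis using action_inj assms(1,2) by (auto dest: inj_onD)
qed

sublocale proj: group_hom S C snd
  by unfold_locales (auto simp: hom_def carrier_S mult_S)

sublocale emb_P: group_hom P S "\<lambda>n. (n, \<one>\<^bsub>C\<^esub>)"
  by unfold_locales (auto simp: hom_def carrier_S mult_S)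

sublocale emb_C: group_hom C S "Pair \<one>\<^bsub>P\<^esub>"
  by unfold_locales (auto simp: hom_def carrier_S mult_S)

\<comment> \<open>As rewrite rules these would loop with \<open>one_S\<close> and \<open>mult_S\<close>.\<close>
lemmas [simp del] = emb_P.hom_one emb_P.hom_mult emb_C.hom_one emb_C.hom_mult emb_C.hom_inv

section \<open>Automorphisms preserve the second component\<close>

text \<open>Embedding \<open>P\<close>, applying \<open>\<alpha>\<close> and projecting gives a
  homomorphism from \<open>P\<close> to \<open>C\<close>, which is trivial because the orders are
  coprime.\<close>

lemma auto_normal_part:
  assumes "\<alpha> \<in> auto S" "n \<in> carrier P"
  shows "snd (\<alpha> (n, \<one>\<^bsub>C\<^esub>)) = \<one>\<^bsub>C\<^esub>"
proof -
  interpret a: group_hom S S \<alpha>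
    using assms(1) S.is_group by (auto simp: auto_def group_hom_def group_hom_axioms_def)
  interpret f: group_hom P C "\<lambda>n. snd (\<alpha> (n, \<one>\<^bsub>C\<^esub>))"
    using hom_compose[OF hom_compose[OF emb_P.homh a.homh] proj.homh]
    by unfold_locales (simp add: comp_def)
  let ?c = "snd (\<alpha> (n, \<one>\<^bsub>C\<^esub>))"
  have c: "?c \<in> carrier C" using assms(2) by simp
  have "?c [^]\<^bsub>C\<^esub> order P = \<one>\<^bsub>C\<^esub>"
    using f.hom_nat_pow[OF assms(2), of "order P"] P.pow_order_eq_1[OF assms(2)] f.hom_one by simp
  then have "C.ord ?c dvd order P" using C.pow_eq_id[OF c] by simp
  moreover have "C.ord ?c dvd order C" using c by (rule C.ord_dvd_group_order)
  ultimately have "C.ord ?c = 1" using coprime_orders coprime_common_divisor_nat by blast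
  then show ?thesis using C.ord_eq_1[OF c] by simp
qed

text \<open>Conjugation by \<open>x\<close> acts on the normal subgroup \<open>P\<close> as \<open>\<theta> (snd x)\<close>. As endomorphisms of a
  cyclic group commute, this action is unchanged when \<open>x\<close> is moved by an automorphism, and
  faithfulness recovers \<open>snd x\<close> from it.\<close>

lemma snd_auto:
  assumes "\<alpha> \<in> auto S" "x \<in> carrier S"
  shows "snd (\<alpha> x) = snd x"
proof -
  interpret a: group_hom S S \<alpha>
    using assms(1) S.is_group by (auto simp: auto_def group_hom_def group_hom_axioms_def)
  define \<beta> where "\<beta> n = fst (\<alpha> (n, \<one>\<^bsub>C\<^esub>))" for n
  have \<beta>: "\<alpha> (n, \<one>\<^bsub>C\<^esub>) = (\<beta> n, \<one>\<^bsub>C\<^esub>)" if "n \<in> carrier P" for n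
    using auto_normal_part[OF assms(1) that] by (simp add: \<beta>_def prod_eq_iff)
  have closed: "\<beta> n \<in> carrier P" if "n \<in> carrier P" for n
    using a.hom_closed[OF emb_P.hom_closed[OF that]] \<beta>[OF that] by (simp add: carrier_S)
  have hom: "\<beta> \<in> hom P P"
  proof (rule homI)
    fix n n' assume n: "n \<in> carrier P" "n' \<in> carrier P"
    have "(\<beta> (n \<otimes>\<^bsub>P\<^esub> n'), \<one>\<^bsub>C\<^esub>) = (\<beta> n, \<one>\<^bsub>C\<^esub>) \<otimes>\<^bsub>S\<^esub> (\<beta> n', \<one>\<^bsub>C\<^esub>)"
      using n by (simp add: emb_P.hom_mult flip: \<beta>)
    then show "\<beta> (n \<otimes>\<^bsub>P\<^esub> n') = \<beta> n \<otimes>\<^bsub>P\<^esub> \<beta> n'"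
      using n closed by (simp add: mult_S)
  qed (rule closed)
  have "inj_on \<alpha> (carrier S)" using assms(1) by (auto simp: auto_def Bij_def bij_betw_def)
  then have "inj_on \<beta> (carrier P)"
    using \<beta> emb_P.hom_closed by (metis (no_types, lifting) inj_on_def prod.inject)
  then have surj: "\<beta> ` carrier P = carrier P"
    using finite_P closed by (intro endo_inj_surj) auto
  obtain k c where x: "x = (k, c)" "k \<in> carrier P" "c \<in> carrier C"
    using assms(2) by (auto simp: carrier_S)
  obtain k' c' where y: "\<alpha> x = (k', c')" "k' \<in> carrier P" "c' \<in> carrier C"
    using a.hom_closed[OF assms(2)] by (auto simp: carrier_S)
  have "\<theta> c' n' = \<theta> c n'" if n': "n' \<in> carrier P" for n'
  proof -
    obtain n where n: "n \<in> carrier P" "n' = \<beta> n" using surj n' by blast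
    have t: "\<theta> c n \<in> carrier P" using action_closed x(3) n(1) .
    \<comment> \<open>This is the conjugation relation without inverses. After applying
      \<open>\<alpha>\<close>, the first component \<open>k'\<close> cancels because
      \<open>P\<close> is commutative.\<close>
    have "x \<otimes>\<^bsub>S\<^esub> (n, \<one>\<^bsub>C\<^esub>) = (\<theta> c n, \<one>\<^bsub>C\<^esub>) \<otimes>\<^bsub>S\<^esub> x"
      using x n(1) t by (simp add: mult_S action_one P.m_comm)
    then have "\<alpha> x \<otimes>\<^bsub>S\<^esub> \<alpha> (n, \<one>\<^bsub>C\<^esub>) = \<alpha> (\<theta> c n, \<one>\<^bsub>C\<^esub>) \<otimes>\<^bsub>S\<^esub> \<alpha> x"
      using assms(2) n(1) t by (metis a.hom_mult emb_P.hom_closed)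
    then have "k' \<otimes>\<^bsub>P\<^esub> \<theta> c' (\<beta> n) = \<beta> (\<theta> c n) \<otimes>\<^bsub>P\<^esub> k'"
      using y n(1) t by (simp add: \<beta> mult_S)
    then have "\<theta> c' (\<beta> n) = \<beta> (\<theta> c n)"
      using y(2,3) n(1) t closed action_closed by (simp add: P.m_comm)
    also have "\<dots> = \<theta> c (\<beta> n)"
      using P.endomorphisms_commute_if_cyclic[OF cyclic_P hom _ n(1)] action_auto[OF x(3)]
      by (simp add: auto_def)
    finally show ?thesis using n(2) by simp
  qed
  then show ?thesis using action_eqI[of c' c] x y by simp
qed

lemma snd_R_Aut_conj:
  assumes "(x, y) \<in> R_Aut_conj S"
  shows "snd x = snd y \<or> snd x = inv\<^bsub>C\<^esub> snd y"
proof -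
  obtain \<alpha> where "y \<in> carrier S" "\<alpha> \<in> auto S" "x = \<alpha> y \<or> x = inv\<^bsub>S\<^esub> (\<alpha> y)"
    using assms unfolding S.R_Aut_conj_iff by blast
  then show ?thesis using snd_auto[of \<alpha> y] S.auto_closed[of \<alpha> y] by (elim disjE) simp_all
qed

text \<open>The kernel of \<open>snd\<close> contains the subgroup generated by \<open>y\<close>,
  and automorphisms preserve \<open>snd\<close>; so \<open>x\<close>, lying in the image of that
  subgroup, is in the kernel too.\<close>

lemma snd_Q_Aut_conj:
  assumes "(x, y) \<in> Q_Aut_conj S" "snd y = \<one>\<^bsub>C\<^esub>"
  shows "snd x = \<one>\<^bsub>C\<^esub>"
proof -
  obtain \<alpha> where y: "y \<in> carrier S" and a: "\<alpha> \<in> auto S" "generate S {x} = \<alpha> ` generate S {y}"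
    using assms(1) unfolding S.Q_Aut_conj_iff by blast
  have "x \<in> \<alpha> ` generate S {y}" using a(2) generate.incl[of x "{x}" S] by simp
  then obtain z where z: "z \<in> generate S {y}" "x = \<alpha> z" by blast
  have "generate S {y} \<subseteq> kernel S C snd"
    using y assms(2) by (intro S.generate_subgroup_incl proj.subgroup_kernel) (simp add: kernel_def)
  then have "z \<in> carrier S" "snd z = \<one>\<^bsub>C\<^esub>" using z(1) by (auto simp: kernel_def)
  then show ?thesis using z(2) snd_auto[OF a(1)] by simp
qed

section \<open>Real classes of the semidirect product\<close>

text \<open>A nontrivial fixed point would generate \<open>P\<close>, so \<open>c\<close> would act
  trivially, against faithfulness.\<close>

lemma action_fixed_point:
  assumes "c \<in> carrier C" "c \<noteq> \<one>\<^bsub>C\<^esub>" "n \<in> carrier P" "\<theta> c n = n"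
  shows "n = \<one>\<^bsub>P\<^esub>"
proof (rule ccontr)
  assume "n \<noteq> \<one>\<^bsub>P\<^esub>"
  then have gen: "generate P {n} = carrier P"
    using P.generate_eq_carrier_if_prime_order prime_order_P assms(3) by blast
  interpret t: group_hom P P "\<theta> c" using assms(1) by (rule action_group_hom)
  have "\<theta> c x = \<theta> \<one>\<^bsub>C\<^esub> x" if x: "x \<in> carrier P" for x
  proof -
    obtain k :: int where "x = n [^]\<^bsub>P\<^esub> k" using x gen P.generate_pow[OF assms(3)] by auto
    then show ?thesis using assms(3,4) t.hom_int_pow[of n k] x by simp
  qed
  then show False using action_eqI[of c "\<one>\<^bsub>C\<^esub>"] assms(1,2) by simp
qed

text \<open>The endomorphism \<open>\<delta>\<close> of the abelian group \<open>P\<close> has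
  trivial kernel because \<open>c\<close> fixes only the unit, so it is onto by finiteness. A
  preimage \<open>a\<close> of the quotient of \<open>n\<close> by \<open>n'\<close> then conjugates
  \<open>(n', c)\<close> to \<open>(n, c)\<close>.\<close>

lemma R_Aut_conj_outside:
  assumes "c \<in> carrier C" "c \<noteq> \<one>\<^bsub>C\<^esub>" "n \<in> carrier P" "n' \<in> carrier P"
  shows "((n, c), (n', c)) \<in> R_Aut_conj S"
proof -
  interpret t: group_hom P P "\<theta> c" using assms(1) by (rule action_group_hom)
  define \<delta> where "\<delta> a = a \<otimes>\<^bsub>P\<^esub> inv\<^bsub>P\<^esub> \<theta> c a" for a
  interpret d: group_hom P P \<delta>
    by unfold_locales (auto simp: hom_def \<delta>_def P.inv_mult P.m_ac)
  have "\<forall>a\<in>carrier P. \<delta> a = \<one>\<^bsub>P\<^esub> \<longrightarrow> a = \<one>\<^bsub>P\<^esub>"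
  proof (intro ballI impI)
    fix a assume a: "a \<in> carrier P" "\<delta> a = \<one>\<^bsub>P\<^esub>"
    then have "\<theta> c a = a" unfolding \<delta>_def using P.inv_equality[of a "inv\<^bsub>P\<^esub> \<theta> c a"] by simp
    then show "a = \<one>\<^bsub>P\<^esub>" using action_fixed_point assms(1,2) a(1) by blast
  qed
  then have "inj_on \<delta> (carrier P)" using d.inj_on_one_iff by blast
  then have "\<delta> ` carrier P = carrier P"
    using finite_P d.hom_closed by (intro endo_inj_surj) auto
  moreover have "n \<otimes>\<^bsub>P\<^esub> inv\<^bsub>P\<^esub> n' \<in> carrier P" using assms(3,4) by simp
  ultimately obtain a where a: "a \<in> carrier P" "n \<otimes>\<^bsub>P\<^esub> inv\<^bsub>P\<^esub> n' = \<delta> a" by (metis imageE)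
  have "a \<otimes>\<^bsub>P\<^esub> n' = \<delta> a \<otimes>\<^bsub>P\<^esub> \<theta> c a \<otimes>\<^bsub>P\<^esub> n'"
    using a(1) by (simp add: \<delta>_def P.m_assoc)
  also have "\<dots> = n \<otimes>\<^bsub>P\<^esub> inv\<^bsub>P\<^esub> n' \<otimes>\<^bsub>P\<^esub> \<theta> c a \<otimes>\<^bsub>P\<^esub> n'" by (simp add: a(2))
  also have "\<dots> = n \<otimes>\<^bsub>P\<^esub> (inv\<^bsub>P\<^esub> n' \<otimes>\<^bsub>P\<^esub> (n' \<otimes>\<^bsub>P\<^esub> \<theta> c a))"
    using a(1) assms(3,4) by (simp add: P.m_assoc P.m_comm[of "\<theta> c a" n'])
  also have "\<dots> = n \<otimes>\<^bsub>P\<^esub> \<theta> c a"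
    using a(1) assms(3,4) by (simp add: P.m_assoc[symmetric, of "inv\<^bsub>P\<^esub> n'"])
  finally have "(a, \<one>\<^bsub>C\<^esub>) \<otimes>\<^bsub>S\<^esub> (n', c) = (n, c) \<otimes>\<^bsub>S\<^esub> (a, \<one>\<^bsub>C\<^esub>)"
    using assms by (simp add: mult_S)
  then show ?thesis
    using assms a(1) by (intro S.R_Aut_conj_if_conjugate[of "(a, \<one>\<^bsub>C\<^esub>)"]) (auto simp: carrier_S)
qed

lemma R_Aut_conj_normal_part:
  assumes "n \<in> carrier P" "n \<noteq> \<one>\<^bsub>P\<^esub>" "n' \<in> carrier P" "n' \<noteq> \<one>\<^bsub>P\<^esub>"
  shows "((n, \<one>\<^bsub>C\<^esub>), (n', \<one>\<^bsub>C\<^esub>)) \<in> R_Aut_conj S"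
proof -
  have gen: "generate P {n} = carrier P" "generate P {n'} = carrier P"
    using P.generate_eq_carrier_if_prime_order prime_order_P assms by blast+
  obtain k :: int where k: "n = n' [^]\<^bsub>P\<^esub> k"
    using gen(2) assms(1) P.generate_pow[OF assms(3)] by auto
  \<comment> \<open>The \<open>k\<close>-th power map of \<open>P\<close> commutes with the action, hence extends to the semidirect product.\<close>
  let ?f = "\<lambda>x. x [^]\<^bsub>P\<^esub> k"
  \<comment> \<open>The image of \<open>?f\<close> contains \<open>n\<close>, the image of
    \<open>n'\<close>, and \<open>n\<close> generates \<open>P\<close>.\<close>
  have "carrier P \<subseteq> ?f ` carrier P"
  proof
    fix x assume "x \<in> carrier P"
    then obtain j :: int where "x = n [^]\<^bsub>P\<^esub> j" using gen(1) P.generate_pow[OF assms(1)] by auto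
    then have "x = ?f (n' [^]\<^bsub>P\<^esub> j)" using k assms(3) by (simp add: P.int_pow_pow mult.commute)
    then show "x \<in> ?f ` carrier P" using assms(3) by blast
  qed
  then have surj: "?f ` carrier P = carrier P" by auto
  then have inj: "inj_on ?f (carrier P)" using finite_P by (intro eq_card_imp_inj_on) auto
  let ?F = "\<lambda>(a, c)\<in>carrier S. (?f a, c)"
  have "bij_betw (map_prod ?f id) (carrier P \<times> carrier C) (carrier P \<times> carrier C)"
    using surj inj by (intro bij_betw_map_prod) (auto simp: bij_betw_def)
  then have "bij_betw ?F (carrier S) (carrier S)"
    using bij_betw_cong[of "carrier S" ?F "map_prod ?f id" "carrier S"] by (auto simp: carrier_S)
  moreover have "?F \<in> hom S S"
  proof (rule homI)
    fix x y assume "x \<in> carrier S" "y \<in> carrier S"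
    then obtain a c b d where xy: "x = (a, c)" "y = (b, d)"
      "a \<in> carrier P" "c \<in> carrier C" "b \<in> carrier P" "d \<in> carrier C"
      by (auto simp: carrier_S)
    then have "\<theta> c (?f b) = ?f (\<theta> c b)"
      using group_hom.hom_int_pow[OF action_group_hom] by blast
    then show "?F (x \<otimes>\<^bsub>S\<^esub> y) = ?F x \<otimes>\<^bsub>S\<^esub> ?F y"
      using xy action_closed by (simp add: carrier_S mult_S P.int_pow_distrib)
  qed (auto simp: carrier_S)
  ultimately have "?F \<in> auto S" by (auto simp: auto_def Bij_def)
  moreover have "(n, \<one>\<^bsub>C\<^esub>) = ?F (n', \<one>\<^bsub>C\<^esub>)" using k assms by (simp add: carrier_S)
  ultimately show ?thesis
    unfolding S.R_Aut_conj_iff using assms(1,3) emb_P.hom_closed by blast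
qed

section \<open>The two bounds for the defect\<close>

lemma card_Pair_image: "card (Pair a ` D) = card D"
  by (intro card_image) (auto simp: inj_on_def)

theorem totient_le_defect:
  "int (totient (order C)) \<le> 2 * conj_class_defect S + 2"
proof -
  define D where "D = {c \<in> carrier C. generate C {c} = carrier C}"
  define Y where "Y = Pair \<one>\<^bsub>P\<^esub> ` D"
  have Y: "Y \<subseteq> carrier S" by (auto simp: Y_def D_def carrier_S)
  have le: "totient (order C) \<le> card Y"
    using C.totient_le_card_generators[OF cyclic_C finite_C] by (simp add: Y_def D_def card_Pair_image)
  then have "Y \<noteq> {}" using order_C_pos by auto
  \<comment> \<open>Elements of \<open>Y\<close> are determined by their second component, which an
    \<open>\<real>\<close>-class fixes up to inversion.\<close>
  have "R_Aut_conj S `` {y} \<inter> Y \<subseteq> {y, (\<one>\<^bsub>P\<^esub>, inv\<^bsub>C\<^esub> snd y)}" if "y \<in> Y" for y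
  proof
    fix z assume z: "z \<in> R_Aut_conj S `` {y} \<inter> Y"
    then have "(z, y) \<in> R_Aut_conj S"
      using S.equiv_R_Aut_conj by (auto simp: equiv_def dest: symD)
    then show "z \<in> {y, (\<one>\<^bsub>P\<^esub>, inv\<^bsub>C\<^esub> snd y)}"
      using snd_R_Aut_conj[of z y] z that by (auto simp: Y_def)
  qed
  then have "card (R_Aut_conj S `` {y} \<inter> Y) \<le> card {y, (\<one>\<^bsub>P\<^esub>, inv\<^bsub>C\<^esub> snd y)}" if "y \<in> Y" for y
    using that by (intro card_mono) auto
  also have "card {y, (\<one>\<^bsub>P\<^esub>, inv\<^bsub>C\<^esub> snd y)} \<le> 2" for y
    by (simp add: card_insert_if)
  finally have "card (R_Aut_conj S `` {y} \<inter> Y) \<le> 2" if "y \<in> Y" for y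
    using that by blast
  then have "card Y \<le> 2 * card (Y // R_Aut_conj S)"
    using S.equiv_R_Aut_conj Y finite_subset[OF Y finite_S] by (intro card_le_mult_card_quotient)
  moreover have "Y \<times> Y \<subseteq> Q_Aut_conj S"
  proof -
    \<comment> \<open>Every member of \<open>Y\<close> generates the same complement of
      \<open>P\<close>, so the identity automorphism relates any two of them.\<close>
    have "generate S {y} = Pair \<one>\<^bsub>P\<^esub> ` carrier C" if y: "y \<in> Y" for y
    proof -
      obtain c where "c \<in> carrier C" "generate C {c} = carrier C" "y = (\<one>\<^bsub>P\<^esub>, c)"
        using y by (auto simp: Y_def D_def)
      then show ?thesis using emb_C.generate_img[of "{c}"] by simp
    qed
    then have "(y, z) \<in> Q_Aut_conj S" if "y \<in> Y" "z \<in> Y" for y z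
      using that Y by (intro S.Q_Aut_conj_if_generate_eq) auto
    then show ?thesis by blast
  qed
  then have "card (carrier S // Q_Aut_conj S) + card (Y // R_Aut_conj S)
      \<le> card (carrier S // R_Aut_conj S) + 1"
    using S.equiv_R_Aut_conj S.equiv_Q_Aut_conj S.R_Aut_conj_subset_Q_Aut_conj finite_S Y \<open>Y \<noteq> {}\<close>
    by (intro card_quotient_refinement)
  ultimately show ?thesis using le by (simp add: conj_class_defect_def)
qed

text \<open>For prime \<open>m\<close> this reads
  \<open>2 * conj_class_defect S + 2 \<le> m - 1\<close>, and \<open>m - 1\<close> is the totient,
  so it matches the lower bound.\<close>

theorem defect_le_if_prime:
  assumes "Factorial_Ring.prime (order C)" "order C \<ge> 3"
  shows "2 * conj_class_defect S + 3 \<le> int (order C)"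
proof -
  let ?R = "R_Aut_conj S" and ?Q = "Q_Aut_conj S"
  define Y where "Y = Pair \<one>\<^bsub>P\<^esub> ` (carrier C - {\<one>\<^bsub>C\<^esub>})"
  have Y: "Y \<subseteq> carrier S" by (auto simp: Y_def carrier_S)
  have fin_Y: "finite Y" using finite_subset[OF Y finite_S] .
  have card_Y: "card Y = order C - 1"
    using finite_C by (simp add: Y_def card_Pair_image order_def)
  have "2 \<le> card (?R `` {y} \<inter> Y)" if y: "y \<in> Y" for y
  proof -
    obtain c where c: "c \<in> carrier C" "c \<noteq> \<one>\<^bsub>C\<^esub>" "y = (\<one>\<^bsub>P\<^esub>, c)" using y by (auto simp: Y_def)
    \<comment> \<open>Otherwise the order of \<open>c\<close>, which is the prime
      \<open>order C\<close>, would divide 2.\<close>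
    have "c \<noteq> inv\<^bsub>C\<^esub> c"
    proof
      assume "c = inv\<^bsub>C\<^esub> c"
      then have "c \<otimes>\<^bsub>C\<^esub> c = \<one>\<^bsub>C\<^esub>" using c(1) C.r_inv[of c] by simp
      then have "c [^]\<^bsub>C\<^esub> (2::nat) = \<one>\<^bsub>C\<^esub>" using c(1) by (simp add: numeral_2_eq_2)
      then have "C.ord c dvd 2" using C.pow_eq_id[OF c(1)] by simp
      moreover have "C.ord c = order C"
        using C.ord_dvd_group_order[OF c(1)] C.ord_eq_1[OF c(1)] c(2) assms(1)
        by (auto simp: prime_nat_iff)
      ultimately show False using assms(2) by (auto dest: dvd_imp_le)
    qed
    have "(y, y) \<in> ?R" using S.equiv_R_Aut_conj y Y by (auto simp: equiv_def refl_on_def)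
    moreover have "(y, (\<one>\<^bsub>P\<^esub>, inv\<^bsub>C\<^esub> c)) \<in> ?R"
      using S.R_Aut_conj_inv[of y] y Y c(1,3) by (auto simp: emb_C.hom_inv)
    ultimately have "{y, (\<one>\<^bsub>P\<^esub>, inv\<^bsub>C\<^esub> c)} \<subseteq> ?R `` {y} \<inter> Y"
      using y c by (auto simp: Y_def)
    then have "card {y, (\<one>\<^bsub>P\<^esub>, inv\<^bsub>C\<^esub> c)} \<le> card (?R `` {y} \<inter> Y)"
      using fin_Y by (intro card_mono) auto
    then show ?thesis using \<open>c \<noteq> inv\<^bsub>C\<^esub> c\<close> c(3) by simp
  qed
  then have card_YR: "2 * card (Y // ?R) \<le> order C - 1"
    using mult_card_quotient_le_card[OF S.equiv_R_Aut_conj Y fin_Y] card_Y by auto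
  obtain n where n: "n \<in> carrier P" "n \<noteq> \<one>\<^bsub>P\<^esub>"
  proof -
    have "card (carrier P - {\<one>\<^bsub>P\<^esub>}) > 0"
      using finite_P prime_gt_1_nat[OF prime_order_P] by (simp add: order_def)
    then show ?thesis using that by (metis Diff_iff card_gt_0_iff ex_in_conv singletonI)
  qed
  obtain c where c: "c \<in> carrier C" "c \<noteq> \<one>\<^bsub>C\<^esub>"
    using card_Y assms(2) by (metis Y_def Diff_iff card.empty diff_is_0_eq equals0I image_is_empty
        insertI1 not_numeral_le_zero numeral_le_one_iff order_trans semiring_norm(70))
  let ?a = "(n, \<one>\<^bsub>C\<^esub>)" and ?x = "(\<one>\<^bsub>P\<^esub>, c)"
  \<comment> \<open>The three kinds of classes are the unit, the nontrivial part of
    \<open>P\<close>, and the classes outside \<open>P\<close>, each represented in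
    \<open>Y\<close>.\<close>
  have "carrier S // ?R \<subseteq> {?R `` {\<one>\<^bsub>S\<^esub>}, ?R `` {?a}} \<union> Y // ?R"
  proof
    fix K assume "K \<in> carrier S // ?R"
    then obtain k d where k: "k \<in> carrier P" "d \<in> carrier C" and K: "K = ?R `` {(k, d)}"
      by (auto simp: quotient_def carrier_S)
    show "K \<in> {?R `` {\<one>\<^bsub>S\<^esub>}, ?R `` {?a}} \<union> Y // ?R"
    proof (cases "d = \<one>\<^bsub>C\<^esub>")
      case True
      show ?thesis
      proof (cases "k = \<one>\<^bsub>P\<^esub>")
        case False
        then have "K = ?R `` {?a}"
          using K True equiv_class_eq[OF S.equiv_R_Aut_conj R_Aut_conj_normal_part[OF k(1) _ n]] by simp
        then show ?thesis by blast
      qed (simp add: K True one_S)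
    next
      case False
      then have "K = ?R `` {(\<one>\<^bsub>P\<^esub>, d)}"
        using K k R_Aut_conj_outside[of d k "\<one>\<^bsub>P\<^esub>"] equiv_class_eq[OF S.equiv_R_Aut_conj] by simp
      then show ?thesis using False k(2) by (auto simp: Y_def intro: quotientI)
    qed
  qed
  moreover have "finite (Y // ?R)" using fin_Y by (simp add: quotient_def)
  ultimately have "card (carrier S // ?R) \<le> card ({?R `` {\<one>\<^bsub>S\<^esub>}, ?R `` {?a}} \<union> Y // ?R)"
    by (intro card_mono) auto
  also have "\<dots> \<le> card {?R `` {\<one>\<^bsub>S\<^esub>}, ?R `` {?a}} + card (Y // ?R)" by (rule card_Un_le)
  also have "\<dots> \<le> 2 + card (Y // ?R)" by (simp add: card_insert_if)
  finally have R: "card (carrier S // ?R) \<le> 2 + card (Y // ?R)" .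
  have mem: "\<one>\<^bsub>S\<^esub> \<in> carrier S" "?a \<in> carrier S" "?x \<in> carrier S"
    using n c by (auto simp: carrier_S one_S)
  \<comment> \<open>The unit is alone in its \<open>\<rat>\<close>-class, and \<open>?x\<close> is
    separated from \<open>?a\<close> by lying outside \<open>P\<close>.\<close>
  have "(?a, \<one>\<^bsub>S\<^esub>) \<notin> ?Q" "(?x, \<one>\<^bsub>S\<^esub>) \<notin> ?Q" "(?x, ?a) \<notin> ?Q"
    using S.Q_Aut_conj_one[of ?a] S.Q_Aut_conj_one[of ?x] snd_Q_Aut_conj[of ?x ?a] n c
    by (auto simp: one_S)
  then have "card {?Q `` {?x}, ?Q `` {?a}, ?Q `` {\<one>\<^bsub>S\<^esub>}} = 3"
    using mem eq_equiv_class_iff[OF S.equiv_Q_Aut_conj] by simp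
  moreover have "card {?Q `` {?x}, ?Q `` {?a}, ?Q `` {\<one>\<^bsub>S\<^esub>}} \<le> card (carrier S // ?Q)"
    using mem finite_S by (intro card_mono) (auto intro: quotientI simp: quotient_def)
  ultimately show ?thesis using R card_YR assms(2) by (simp add: conj_class_defect_def)
qed

end

section \<open>Transfer of the bounds to an isomorphic group\<close>

theorem mainTheorem4:
  fixes P :: "('a, 'x) monoid_scheme"
    and C :: "('b, 'y) monoid_scheme"
    and G :: "('g, 'z) monoid_scheme"
    and \<theta> :: "'b \<Rightarrow> 'a \<Rightarrow> 'a"
    and p m :: nat
  assumes "Factorial_Ring.prime p" and "m \<ge> 3" and "m dvd (p - 1)"
    and "group P" and "cyclic_group P" and "order P = p"
    and "group C" and "cyclic_group C" and "order C = m"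
    and "\<theta> \<in> hom C (AutoGroup P)" and "inj_on \<theta> (carrier C)"
    and "group G" and "G \<cong> semidirect_product P C \<theta>"
  shows "real_of_int (conj_class_defect G) \<ge> real (totient m) / 2 - 1 \<and>
         (Factorial_Ring.prime m \<longrightarrow> real_of_int (conj_class_defect G) = real (totient m) / 2 - 1) \<and>
         (m = 5 \<or> m \<ge> 7 \<longrightarrow> conj_class_defect G > 0)"
proof -
  interpret faithful_prime_semidirect_product P C \<theta>
    using assms
    by (simp add: faithful_prime_semidirect_product_def faithful_prime_semidirect_product_axioms_def)
  obtain \<psi> where "\<psi> \<in> iso G S" using assms(13) by (auto simp: is_iso_def)
  then have "finite (carrier G)"
    using finite_S bij_betw_finite[of \<psi> "carrier G" "carrier S"] by (simp add: iso_def)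
  then have G: "conj_class_defect G = conj_class_defect S"
    using group.conj_class_defect_iso[OF assms(12) S.is_group assms(13)] by simp
  have lower: "int (totient m) \<le> 2 * conj_class_defect G + 2"
    using totient_le_defect assms(9) G by simp
  have "2 * conj_class_defect G + 2 = int (totient m)" if "Factorial_Ring.prime m"
    using lower defect_le_if_prime that assms(2,9) G by (simp add: totient_prime of_nat_diff)
  \<comment> \<open>A totient above 2 makes twice the defect positive in the lower bound.\<close>
  moreover have "conj_class_defect G > 0" if "m = 5 \<or> m \<ge> 7"
    using lower totient_gt_2[OF that] by simp
  ultimately show ?thesis using lower by (fastforce simp: field_simps)
qed

end
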